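(* Assume that the family $(a(\cdot,\omega))_{\omega\in\Omega}$ is equi-bounded and equi-Lipschitz continuous on $\mathbb R^n$ with Lipschitz constant $L>0$, and that there is $\delta_0>0$ such that $U^\delta(\omega)$ is connected for every $\delta\in(0,\delta_0)$. Let $\mu>0$ and let $m_\mu$ be the maximal subsolution of the metric problem in $U(\omega)$ defined in the context. Then, for all $y,z\in U(\omega)$, $$m_\mu(y,z,\omega)\ \ge\ \frac{\mu}{L}\,\big|\log a(y,\omega)-\log a(z,\omega)\big|,$$ and, for each fixed $z\in U(\omega)$, $$\lim_{\substack{\operatorname{dist}(y,\partial U(\omega))\to0\\ y\in U(\omega)}}m_\mu(y,z,\omega)=+\infty.$$
   Context: $(\Omega,\mathcal F,\mathbb P)$ is a probability space and $a:\mathbb R^n\times\Omega\to\mathbb R$ is a measurable function with $a(\cdot,\omega)$ continuous. Fix $\omega\in\Omega$ and let $U(\omega)$ be an unbounded connected component of $\{x\in\mathbb R^n:a(x,\omega)>0\}$ with $\partial U(\omega)\subseteq\{x:a(x,\omega)=0\}$. For $\delta>0$, $U^\delta(\omega):=\{x\in U(\omega):a(x,\omega)>\delta\}$. $\mathcal L$ is the class of Lipschitz functions on $\mathbb R^n$. For $\mu>0$, $\mathcal S_\mu(U(\omega))$ is the class of functions $w$ such that for each $\eta>0$ sufficiently small there exists $\overline\delta=\overline\delta(\eta)>0$, independent of $\omega$, with $\lim_{\eta\to0}\overline\delta(\eta)=0$ and $|w(y_1)-w(y_2)|\le(\mu/\delta+\eta)|y_1-y_2|$ for all $\delta\in(0,\overline\delta)$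 and $y_1,y_2\in U^\delta(\omega)$. $\mathcal L_\mu(U(\omega)):=\mathcal L\cap\mathcal S_\mu(U(\omega))$. For $z,y\in U(\omega)$, $$m_\mu(y,z,\omega):=\sup\{w(y,\omega): w(\cdot,\omega)\in\mathcal L_\mu(U(\omega)),\ w(z,\omega)=0,\ a(\cdot,\omega)|Dw|\le\mu\text{ in }U(\omega)\},$$ the differential inequality being understood in the viscosity sense (equivalently, almost everywhere). *)

theory Defs
  imports "HOL-Probability.Probability"
begin

text \<open>Random functions are curried with the spatial variable first: \<open>a x \<omega>\<close>, \<open>w x \<omega>\<close>.\<close>

definition superlevel ::
  "(real^'n \<Rightarrow> 'w \<Rightarrow> real) \<Rightarrow> ('w \<Rightarrow> (real^'n) set) \<Rightarrow> real \<Rightarrow> 'w \<Rightarrow> (real^'n) set" where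
  "superlevel a U \<delta> \<omega> = {x \<in> U \<omega>. a x \<omega> > \<delta>}"

definition lipschitz_class :: "'w measure \<Rightarrow> (real^'n \<Rightarrow> 'w \<Rightarrow> real) set" where
  "lipschitz_class M = {w. \<forall>\<omega>\<in>space M. \<exists>C. C-lipschitz_on UNIV (\<lambda>x. w x \<omega>)}"

text \<open>
  The threshold \<open>\<delta>bar \<eta>\<close> must not depend on \<open>\<omega>\<close>. The class therefore consists of
  families \<open>w\<close>, and \<open>\<delta>bar\<close> is chosen before \<open>\<omega>\<close>. "For \<open>\<eta> > 0\<close> sufficiently small"
  is the filter \<open>at_right 0\<close>.
\<close>

definition S_class ::
  "'w measure \<Rightarrow> (real^'n \<Rightarrow> 'w \<Rightarrow> real) \<Rightarrow> ('w \<Rightarrow> (real^'n) set) \<Rightarrow> real \<Rightarrow>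
   (real^'n \<Rightarrow> 'w \<Rightarrow> real) set" where
  "S_class M a U \<mu> = {w. \<exists>\<delta>bar :: real \<Rightarrow> real.
     (\<delta>bar \<longlongrightarrow> 0) (at_right 0) \<and>
     (\<forall>\<^sub>F \<eta> in at_right 0. \<delta>bar \<eta> > 0 \<and>
        (\<forall>\<omega>\<in>space M. \<forall>\<delta>\<in>{0<..<\<delta>bar \<eta>}.
           \<forall>y1\<in>superlevel a U \<delta> \<omega>. \<forall>y2\<in>superlevel a U \<delta> \<omega>.
             \<bar>w y1 \<omega> - w y2 \<omega>\<bar> \<le> (\<mu> / \<delta> + \<eta>) * norm (y1 - y2)))}"

definition L_class ::
  "'w measure \<Rightarrow> (real^'n \<Rightarrow> 'w \<Rightarrow> real) \<Rightarrow> ('w \<Rightarrow> (real^'n) set) \<Rightarrow> real \<Rightarrow>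
   (real^'n \<Rightarrow> 'w \<Rightarrow> real) set" where
  "L_class M a U \<mu> = lipschitz_class M \<inter> S_class M a U \<mu>"

text \<open>
  \<open>b |Dw| \<le> \<mu>\<close> in the open set \<open>V\<close> in the viscosity sense: continuously differentiable
  test functions \<open>\<phi>\<close> (with gradient \<open>G\<close>) touch \<open>w\<close> from above, that is,
  \<open>w - \<phi>\<close> has a local maximum at \<open>x0\<close>.
\<close>

definition viscosity_subsolution ::
  "(real^'n) set \<Rightarrow> (real^'n \<Rightarrow> real) \<Rightarrow> real \<Rightarrow> (real^'n \<Rightarrow> real) \<Rightarrow> bool" where
  "viscosity_subsolution V b \<mu> w \<longleftrightarrow>
     (\<forall>x0\<in>V. \<forall>\<phi> :: real^'n \<Rightarrow> real. \<forall>G :: real^'n \<Rightarrow> real^'n.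
        (\<forall>x\<in>V. GDERIV \<phi> x :> G x) \<longrightarrow> continuous_on V G \<longrightarrow>
        (\<forall>\<^sub>F x in nhds x0. w x - \<phi> x \<le> w x0 - \<phi> x0) \<longrightarrow>
        b x0 * norm (G x0) \<le> \<mu>)"

text \<open>The supremum is taken in the extended reals, so that no boundedness is presupposed.\<close>

definition m_metric ::
  "'w measure \<Rightarrow> (real^'n \<Rightarrow> 'w \<Rightarrow> real) \<Rightarrow> ('w \<Rightarrow> (real^'n) set) \<Rightarrow> real \<Rightarrow>
   real^'n \<Rightarrow> real^'n \<Rightarrow> 'w \<Rightarrow> ereal" where
  "m_metric M a U \<mu> y z \<omega> =
     Sup {ereal (w y \<omega>) | w. w \<in> L_class M a U \<mu> \<and> w z \<omega> = 0 \<and>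
            viscosity_subsolution (U \<omega>) (\<lambda>x. a x \<omega>) \<mu> (\<lambda>x. w x \<omega>)}"

text \<open>
  Unlike \<open>infdist\<close>, which is \<open>0\<close> for the empty set, this distance to the empty set is
  \<open>\<infinity>\<close>. The difference matters when \<open>U \<omega>\<close> is the whole space.
\<close>

definition edist_set :: "'b::metric_space \<Rightarrow> 'b set \<Rightarrow> ereal" where
  "edist_set y S = (INF s\<in>S. ereal (dist y s))"

definition near_frontier :: "'b::metric_space set \<Rightarrow> 'b filter" where
  "near_frontier V =
     inf (filtercomap (\<lambda>y. edist_set y (frontier V)) (nhds 0)) (principal V)"

end

theory Submission
  imports Defs
begin

text \<open>
  The functions \<open>\<plusminus> (\<mu> / L) ln (max \<epsilon> a)\<close>, normalised to vanish at \<open>z\<close>, compete in the supremum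
  defining \<open>m\<close>: since \<open>ln\<close> is \<open>1/\<delta>\<close>-Lipschitz on \<open>[\<delta>, \<infinity>)\<close>, they are \<open>\<mu>/\<epsilon>\<close>-Lipschitz on the
  whole space and \<open>\<mu>/\<delta>\<close>-Lipschitz where \<open>a > \<delta>\<close>, and near a point \<open>x\<close> with \<open>a x > 0\<close> their
  slope is at most about \<open>\<mu> / a x\<close>. For \<open>\<epsilon> \<le> min (a y) (a z)\<close> the truncation is invisible at
  \<open>y\<close> and \<open>z\<close>, which gives the lower bound. It blows up at the boundary because
  \<open>a y \<le> L dist(y, \<partial>U)\<close>.
\<close>

text \<open>Concavity: the tangent to \<open>ln\<close> at \<open>q\<close> has slope
  \<open>1/q\<close>, at most \<open>1/\<delta>\<close>. This bounds one sign of the difference;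
  exchanging \<open>p\<close> and \<open>q\<close> bounds the other.\<close>

lemma abs_ln_diff_le:
  fixes p q \<delta> :: real
  assumes "0 < \<delta>" "\<delta> \<le> p" "\<delta> \<le> q"
  shows "\<bar>ln p - ln q\<bar> \<le> \<bar>p - q\<bar> / \<delta>"
proof -
  have *: "ln p - ln q \<le> \<bar>p - q\<bar> / \<delta>" if "\<delta> \<le> p" "\<delta> \<le> q" for p q :: real
  proof -
    have "ln p - ln q \<le> (p - q) / q"
      using ln_diff_le[of p q] that assms(1) by simp
    also have "\<dots> \<le> \<bar>p - q\<bar> / q"
      using that assms(1) by (intro divide_right_mono) auto
    also have "\<dots> \<le> \<bar>p - q\<bar> / \<delta>"
      using that assms(1) by (intro divide_left_mono) auto
    finally show ?thesis .
  qed
  show ?thesis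
    using *[of p q] *[of q p] assms by (auto simp: abs_if abs_minus_commute)
qed

lemma abs_ln_max_diff_le:
  fixes p q \<delta> \<epsilon> :: real
  assumes "0 < \<delta>" "\<delta> \<le> max \<epsilon> p" "\<delta> \<le> max \<epsilon> q"
  shows "\<bar>ln (max \<epsilon> p) - ln (max \<epsilon> q)\<bar> \<le> \<bar>p - q\<bar> / \<delta>"
proof -
  have "\<bar>ln (max \<epsilon> p) - ln (max \<epsilon> q)\<bar> \<le> \<bar>max \<epsilon> p - max \<epsilon> q\<bar> / \<delta>"
    by (rule abs_ln_diff_le[OF assms])
  also have "\<dots> \<le> \<bar>p - q\<bar> / \<delta>"
    using assms(1) by (intro divide_right_mono) (auto simp: max_def abs_if)
  finally show ?thesis .
qed

text \<open>Moving from \<open>x\<close> against the gradient, \<open>\<phi>\<close> falls at rate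
  \<open>norm G\<close> to first order, so a one-sided bound on its decrease is enough.\<close>

lemma norm_gradient_le:
  fixes \<phi> :: "'a::real_inner \<Rightarrow> real"
  assumes D: "GDERIV \<phi> x :> G"
    and ev: "\<forall>\<^sub>F y in nhds x. \<phi> x - \<phi> y \<le> c * norm (y - x)"
    and "0 \<le> c"
  shows "norm G \<le> c"
proof (rule field_le_epsilon)
  fix e :: real assume e: "e > 0"
  from D e obtain d1 where d1: "d1 > 0"
    "\<And>y. norm (y - x) < d1 \<Longrightarrow> \<bar>\<phi> y - \<phi> x - (y - x) \<bullet> G\<bar> \<le> e * norm (y - x)"
    unfolding gderiv_def has_derivative_at_alt by (metis real_norm_def)
  from ev obtain d2 where d2: "d2 > 0"
    "\<And>y. norm (y - x) < d2 \<Longrightarrow> \<phi> x - \<phi> y \<le> c * norm (y - x)"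
    unfolding eventually_nhds_metric dist_norm by blast
  show "norm G \<le> c + e"
  proof (cases "G = 0")
    case False
    \<comment> \<open>The step length \<open>t * norm G\<close> is half of the smaller radius, so
      both local estimates apply at \<open>y\<close>.\<close>
    define t where "t = min d1 d2 / (2 * norm G)"
    have t: "t > 0" "t * norm G < d1" "t * norm G < d2"
      using d1(1) d2(1) False by (auto simp: t_def min_def)
    define y where "y = x - t *\<^sub>R G"
    have y: "norm (y - x) = t * norm G" "(y - x) \<bullet> G = - (t * (norm G * norm G))"
      using t(1) by (simp_all add: y_def power2_norm_eq_inner[symmetric] power2_eq_square)
    have "t * (norm G * norm G) \<le> (c + e) * (t * norm G)"
      using d1(2)[of y] d2(2)[of y] t y by (simp add: algebra_simps abs_le_iff)
    hence "(t * norm G) * norm G \<le> (t * norm G) * (c + e)"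
      by (simp add: mult_ac)
    thus ?thesis
      using t(1) False by simp
  qed (use e assms(3) in simp)
qed

text \<open>Touching from above gives \<open>\<phi> x - \<phi> y \<le> w x - w y\<close> near
  \<open>x\<close>, so the test function inherits the local slope bound of \<open>w\<close>. Only
  constants strictly above \<open>\<mu> / b x\<close> are required, which leaves room for
  \<open>b\<close> to vary near \<open>x\<close>; the limit in \<open>c\<close> restores the sharp
  bound.\<close>

lemma viscosity_subsolutionI:
  assumes loc: "\<And>x c. x \<in> V \<Longrightarrow> \<mu> / b x < c \<Longrightarrow> \<forall>\<^sub>F y in nhds x. \<bar>w y - w x\<bar> \<le> c * norm (y - x)"
    and b: "\<And>x. x \<in> V \<Longrightarrow> b x > 0" and "\<mu> \<ge> 0"
  shows "viscosity_subsolution V b \<mu> w"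
  unfolding viscosity_subsolution_def
proof (intro ballI allI impI)
  fix x \<phi> G
  assume x: "x \<in> V" and G: "\<forall>x\<in>V. GDERIV \<phi> x :> G x"
    and max: "\<forall>\<^sub>F y in nhds x. w y - \<phi> y \<le> w x - \<phi> x"
  have "norm (G x) \<le> \<mu> / b x"
  proof (rule dense_ge)
    fix c assume c: "\<mu> / b x < c"
    have "\<forall>\<^sub>F y in nhds x. \<phi> x - \<phi> y \<le> c * norm (y - x)"
      using max loc[OF x c] by eventually_elim auto
    moreover have "0 \<le> c"
      using c b[OF x] assms(3) by (smt (verit) divide_nonneg_pos)
    ultimately show "norm (G x) \<le> c"
      using norm_gradient_le[of \<phi> x "G x" c] G x by blast
  qed
  thus "b x * norm (G x) \<le> \<mu>"
    using b[OF x] by (simp add: field_simps)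
qed

text \<open>Bounding the truncated values from below lets one estimate serve three times:
  \<open>\<delta> = \<epsilon>\<close> gives the global Lipschitz constant,
  \<open>\<delta> < a\<close> the bound on superlevel sets, and a \<open>\<delta>\<close> just below
  \<open>f x\<close> the viscosity inequality.\<close>

lemma log_competitor_diff_le:
  fixes f :: "'a::real_normed_vector \<Rightarrow> real"
  assumes "L-lipschitz_on UNIV f" "0 < L" "0 < \<delta>" "\<delta> \<le> max \<epsilon> (f x)" "\<delta> \<le> max \<epsilon> (f y)"
    and "\<bar>c\<bar> = \<mu> / L"
  shows "\<bar>c * ln (max \<epsilon> (f x)) - c * ln (max \<epsilon> (f y))\<bar> \<le> \<mu> / \<delta> * norm (x - y)"
proof -
  have "\<bar>c * ln (max \<epsilon> (f x)) - c * ln (max \<epsilon> (f y))\<bar>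
      = \<bar>c\<bar> * \<bar>ln (max \<epsilon> (f x)) - ln (max \<epsilon> (f y))\<bar>"
    by (simp add: abs_mult flip: right_diff_distrib)
  also have "\<dots> \<le> \<bar>c\<bar> * (\<bar>f x - f y\<bar> / \<delta>)"
    using abs_ln_max_diff_le[OF assms(3-5)] by (intro mult_left_mono) auto
  also have "\<dots> \<le> \<bar>c\<bar> * (L * norm (x - y) / \<delta>)"
    using lipschitz_onD[OF assms(1), of x y] assms(3)
    by (intro mult_left_mono divide_right_mono) (auto simp: dist_norm)
  also have "\<dots> = \<mu> / \<delta> * norm (x - y)"
    using assms(2) by (simp add: assms(6))
  finally show ?thesis .
qed

lemma log_competitor_in_L_class:
  fixes a :: "real^'n \<Rightarrow> 'w \<Rightarrow> real"
  assumes lip: "\<And>\<omega>. \<omega> \<in> space M \<Longrightarrow> L-lipschitz_on UNIV (\<lambda>x. a x \<omega>)"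
    and "0 < L" "0 < \<epsilon>" "\<bar>c\<bar> = \<mu> / L"
  shows "(\<lambda>x \<omega>. c * ln (max \<epsilon> (a x \<omega>)) - k) \<in> L_class M a U \<mu>"
proof -
  let ?w = "\<lambda>x \<omega>. c * ln (max \<epsilon> (a x \<omega>)) - k"
  have bound: "\<bar>?w x \<omega> - ?w y \<omega>\<bar> \<le> \<mu> / \<delta> * norm (x - y)"
    if "\<omega> \<in> space M" "0 < \<delta>" "\<delta> \<le> max \<epsilon> (a x \<omega>)" "\<delta> \<le> max \<epsilon> (a y \<omega>)" for x y \<omega> \<delta>
    using log_competitor_diff_le[OF lip[OF that(1)] assms(2) that(2-4) assms(4)] by simp
  have "\<mu> \<ge> 0"
    using assms(2,4) by (metis abs_ge_zero zero_le_divide_iff not_less)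
  have "(\<mu> / \<epsilon>)-lipschitz_on UNIV (\<lambda>x. ?w x \<omega>)" if "\<omega> \<in> space M" for \<omega>
    using bound[OF that, of \<epsilon>] assms(3) \<open>\<mu> \<ge> 0\<close>
    by (intro lipschitz_onI) (auto simp: dist_norm)
  moreover have "?w \<in> S_class M a U \<mu>"
    unfolding S_class_def mem_Collect_eq
  \<comment> \<open>The bound \<open>\<mu> / \<delta>\<close> holds for every positive
    \<open>\<delta>\<close>, uniformly in the random parameter, so the simplest positive threshold
    tending to 0 will do; \<open>\<eta>\<close> is mere slack.\<close>
  proof (intro exI[of _ "\<lambda>\<eta>. \<eta>"] conjI)
    show "\<forall>\<^sub>F \<eta> in at_right 0. \<eta> > 0 \<and>
        (\<forall>\<omega>\<in>space M. \<forall>\<delta>\<in>{0<..<\<eta>}. \<forall>y1\<in>superlevel a U \<delta> \<omega>. \<forall>y2\<in>superlevel a U \<delta> \<omega>.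
             \<bar>?w y1 \<omega> - ?w y2 \<omega>\<bar> \<le> (\<mu> / \<delta> + \<eta>) * norm (y1 - y2))"
      using eventually_at_right_less[of "0::real"]
    proof eventually_elim
      case (elim \<eta>)
      have "\<bar>?w x \<omega> - ?w y \<omega>\<bar> \<le> (\<mu> / \<delta> + \<eta>) * norm (x - y)"
        if "\<omega> \<in> space M" "0 < \<delta>" "\<delta> < a x \<omega>" "\<delta> < a y \<omega>" for \<omega> \<delta> x y
      proof -
        have "\<bar>?w x \<omega> - ?w y \<omega>\<bar> \<le> \<mu> / \<delta> * norm (x - y)"
          using that by (intro bound) auto
        also have "\<dots> \<le> (\<mu> / \<delta> + \<eta>) * norm (x - y)"
          using elim by (intro mult_right_mono) auto
        finally show ?thesis .
      qed
      with elim show ?case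
        by (auto simp: superlevel_def)
    qed
  qed (rule tendsto_ident_at)
  ultimately show ?thesis
    by (auto simp: L_class_def lipschitz_class_def)
qed

lemma log_competitor_viscosity_subsolution:
  fixes f :: "real^'n \<Rightarrow> real"
  assumes lip: "L-lipschitz_on UNIV f"
    and "0 < L" "\<bar>c\<bar> = \<mu> / L" "\<mu> > 0" and pos: "\<And>x. x \<in> V \<Longrightarrow> f x > 0"
  shows "viscosity_subsolution V f \<mu> (\<lambda>x. c * ln (max \<epsilon> (f x)) - k)"
proof (rule viscosity_subsolutionI)
  fix x C assume x: "x \<in> V" and C: "\<mu> / f x < C"
  have "C > 0"
    using C pos[OF x] \<open>\<mu> > 0\<close> by (smt (verit) divide_pos_pos)
  \<comment> \<open>The level \<open>\<delta> = \<mu> / C\<close> turns the Lipschitz constant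
    \<open>\<mu> / \<delta>\<close> into exactly \<open>C\<close>. It lies strictly below
    \<open>f x\<close>, hence below \<open>f\<close> near \<open>x\<close>.\<close>
  have lt: "\<mu> / C < f x"
    using C pos[OF x] \<open>C > 0\<close> by (simp add: field_simps)
  have "(f \<longlongrightarrow> f x) (nhds x)"
    using lipschitz_on_continuous_on[OF lip] by (simp add: continuous_on_eq_continuous_at isCont_def tendsto_nhds_iff)
  hence "\<forall>\<^sub>F y in nhds x. \<mu> / C < f y"
    using lt by (rule order_tendstoD)
  thus "\<forall>\<^sub>F y in nhds x. \<bar>(c * ln (max \<epsilon> (f y)) - k) - (c * ln (max \<epsilon> (f x)) - k)\<bar> \<le> C * norm (y - x)"
  proof eventually_elim
    case (elim y)
    show ?case
      using log_competitor_diff_le[OF lip assms(2), of "\<mu> / C" \<epsilon> y x c \<mu>] elim lt assms(3,4) \<open>C > 0\<close>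
      by simp
  qed
qed (use assms in auto)

theorem proposition2:
  fixes M :: "'w measure"
    and a :: "real^'n \<Rightarrow> 'w \<Rightarrow> real"
    and U :: "'w \<Rightarrow> (real^'n) set"
    and \<omega> :: 'w
    and L \<mu> :: real
  assumes "prob_space M"
    and "(\<lambda>(x, \<omega>). a x \<omega>) \<in> borel_measurable (borel \<Otimes>\<^sub>M M)"
    and "\<And>\<omega>. \<omega> \<in> space M \<Longrightarrow> continuous_on UNIV (\<lambda>x. a x \<omega>)"
    and "\<exists>B. \<forall>\<omega>\<in>space M. \<forall>x. \<bar>a x \<omega>\<bar> \<le> B"
    and "L > 0"
    and "\<And>\<omega>. \<omega> \<in> space M \<Longrightarrow> L-lipschitz_on UNIV (\<lambda>x. a x \<omega>)"
    and "\<omega> \<in> space M"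
    and "U \<omega> \<in> components {x. a x \<omega> > 0}"
    and "\<not> bounded (U \<omega>)"
    and "frontier (U \<omega>) \<subseteq> {x. a x \<omega> = 0}"
    and "\<exists>\<delta>0>0. \<forall>\<delta>\<in>{0<..<\<delta>0}. connected (superlevel a U \<delta> \<omega>)"
    and "\<mu> > 0"
  shows "(\<forall>y\<in>U \<omega>. \<forall>z\<in>U \<omega>.
            m_metric M a U \<mu> y z \<omega> \<ge> ereal (\<mu> / L * \<bar>ln (a y \<omega>) - ln (a z \<omega>)\<bar>)) \<and>
         (\<forall>z\<in>U \<omega>.
            ((\<lambda>y. m_metric M a U \<mu> y z \<omega>) \<longlongrightarrow> \<infinity>) (near_frontier (U \<omega>)))"
proof (intro conjI ballI)
  note lip = assms(6) and \<omega> = assms(7)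
  have pos: "a x \<omega> > 0" if "x \<in> U \<omega>" for x
    using in_components_subset[OF assms(8)] that by auto
  show lower: "m_metric M a U \<mu> y z \<omega> \<ge> ereal (\<mu> / L * \<bar>ln (a y \<omega>) - ln (a z \<omega>)\<bar>)"
    if y: "y \<in> U \<omega>" and z: "z \<in> U \<omega>" for y z
  proof -
    define \<epsilon> where "\<epsilon> = min (a y \<omega>) (a z \<omega>)"
    have \<epsilon>: "\<epsilon> > 0" "max \<epsilon> (a y \<omega>) = a y \<omega>" "max \<epsilon> (a z \<omega>) = a z \<omega>"
      using pos[OF y] pos[OF z] by (auto simp: \<epsilon>_def)
    \<comment> \<open>The sign makes the increment from \<open>z\<close> to \<open>y\<close>
      nonnegative, which produces the absolute value.\<close>
    define c where "c = (if a z \<omega> \<le> a y \<omega> then \<mu> / L else - (\<mu> / L))"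
    have c: "\<bar>c\<bar> = \<mu> / L"
      using assms(5,12) by (auto simp: c_def)
    \<comment> \<open>A competitor is a whole family in \<open>\<omega>'\<close>, but the subtracted
      constant is taken at the fixed \<open>\<omega>\<close>: only there must \<open>w\<close>
      vanish at \<open>z\<close>.\<close>
    define w where "w = (\<lambda>x \<omega>'. c * ln (max \<epsilon> (a x \<omega>')) - c * ln (max \<epsilon> (a z \<omega>)))"
    have "w y \<omega> = \<mu> / L * \<bar>ln (a y \<omega>) - ln (a z \<omega>)\<bar>"
      using pos[OF y] pos[OF z] by (simp add: w_def \<epsilon> c_def abs_if right_diff_distrib diff_divide_distrib)
    moreover have "w \<in> L_class M a U \<mu>"
      unfolding w_def by (rule log_competitor_in_L_class[OF lip assms(5) \<epsilon>(1) c])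
    moreover have "viscosity_subsolution (U \<omega>) (\<lambda>x. a x \<omega>) \<mu> (\<lambda>x. w x \<omega>)"
      unfolding w_def
      by (rule log_competitor_viscosity_subsolution[OF lip[OF \<omega>] assms(5) c assms(12) pos])
    moreover have "w z \<omega> = 0"
      by (simp add: w_def)
    ultimately show ?thesis
      unfolding m_metric_def by (intro Sup_upper CollectI exI[of _ w]) simp
  qed
  show "((\<lambda>y. m_metric M a U \<mu> y z \<omega>) \<longlongrightarrow> \<infinity>) (near_frontier (U \<omega>))" if z: "z \<in> U \<omega>" for z
    unfolding tendsto_PInfty
  proof
    fix K :: real
    \<comment> \<open>Chosen so that the lower bound equals \<open>\<bar>K\<bar>\<close> when
      \<open>a y \<omega> = e\<close>; a distance below \<open>e / L\<close> from the frontier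
      forces \<open>a y \<omega> < e\<close>.\<close>
    define e where "e = exp (ln (a z \<omega>) - \<bar>K\<bar> * L / \<mu>)"
    have "\<forall>\<^sub>F d in nhds 0. d < ereal (e / L)"
      using assms(5) by (intro order_tendstoD(2)[OF filterlim_ident]) (simp add: e_def zero_ereal_def)
    hence "\<forall>\<^sub>F y in near_frontier (U \<omega>). edist_set y (frontier (U \<omega>)) < ereal (e / L) \<and> y \<in> U \<omega>"
      unfolding near_frontier_def eventually_inf_principal
      by (rule eventually_mono[OF eventually_filtercomapI]) auto
    thus "\<forall>\<^sub>F y in near_frontier (U \<omega>). ereal K < m_metric M a U \<mu> y z \<omega>"
    proof eventually_elim
      case (elim y)
      \<comment> \<open>The infimum need not be attained, but lying strictly below
        \<open>e / L\<close> it yields a frontier point this close. An empty frontier has distance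
        \<infinity>, so it needs no separate case.\<close>
      then obtain s where s: "s \<in> frontier (U \<omega>)" "dist y s < e / L"
        by (auto simp: edist_set_def INF_less_iff)
      have "a y \<omega> \<le> L * dist y s"
        using lipschitz_onD[OF lip[OF \<omega>], of y s] s(1) assms(10) by (auto simp: dist_norm)
      also have "\<dots> < e"
        using s(2) assms(5) by (simp add: field_simps)
      finally have "ln (a y \<omega>) < ln e"
        using pos[of y] elim by (subst ln_less_cancel_iff) (auto simp: e_def)
      hence "\<bar>K\<bar> * L / \<mu> < \<bar>ln (a y \<omega>) - ln (a z \<omega>)\<bar>"
        by (simp add: e_def)
      hence "\<bar>K\<bar> < \<mu> / L * \<bar>ln (a y \<omega>) - ln (a z \<omega>)\<bar>"
        using assms(5,12) by (simp add: field_simps)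
      hence "ereal K < ereal (\<mu> / L * \<bar>ln (a y \<omega>) - ln (a z \<omega>)\<bar>)"
        by simp
      also have "\<dots> \<le> m_metric M a U \<mu> y z \<omega>"
        using lower elim z by blast
      finally show ?case .
    qed
  qed
qed

end
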